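(* For every $n\ge 0$, the number of simsun permutations of length $n$ that avoid the pattern $231$ is the Motzkin number $M_n$: $$|\mathcal{RS}_n(231)|=M_n.$$
   Context: $\mathfrak{S}_n$ is the set of permutations of $\{1,\dots,n\}$, written in one-line notation $\pi=\pi_1\pi_2\dots\pi_n$ ($\mathfrak{S}_0$ consists of the empty permutation). A permutation $\pi\in\mathfrak{S}_n$ is simsun if for every $3\le k\le n$, the subword of $\pi_1\pi_2\dots\pi_n$ consisting of the entries in $\{1,\dots,k\}$ (kept in their order) has no double descent, i.e. no three entries that are consecutive in that subword and in decreasing order. A permutation $\pi\in\mathfrak{S}_n$ avoids the pattern $\sigma\in\mathfrak{S}_k$ if there are no indices $i_1<i_2<\dots<i_k$ such that $\pi_{i_1}\pi_{i_2}\dots\pi_{i_k}$ is in the same relative order as $\sigma$. $\mathcal{RS}_n(\sigma)$ is the set of simsun permutations in $\mathfrak{S}_n$ avoiding $\sigma$. The Motzkin number $M_n$ is the number of lattice paths from $(0,0)$ to $(n,0)$ with steps $(1,1)$, $(1,-1)$, $(1,0)$ that never go below the $x$-axis; equivalently $\sum_{n\ge0} M_n z^n = \frac{1-z-\sqrt{1-2z-3z^2}}{2z^2}$. *)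

theory Defs
  imports
    "HOL-Library.Product_Plus"
    "HOL-Combinatorics.Multiset_Permutations"
begin

text \<open>
  A permutation of \<open>{1..n}\<close> in one-line notation is an element of
  \<^term>\<open>permutations_of_set {1..n}\<close>; list positions are counted from 0.
\<close>

definition has_double_descent :: "nat list \<Rightarrow> bool" where
  "has_double_descent w \<longleftrightarrow>
     (\<exists>i. i + 2 < length w \<and> w ! i > w ! (i + 1) \<and> w ! (i + 1) > w ! (i + 2))"

definition simsun :: "nat list \<Rightarrow> bool" where
  "simsun \<pi> \<longleftrightarrow>
     (\<forall>k. 3 \<le> k \<and> k \<le> length \<pi> \<longrightarrow> \<not> has_double_descent (filter (\<lambda>x. x \<in> {1..k}) \<pi>))"

definition contains_pattern :: "nat list \<Rightarrow> nat list \<Rightarrow> bool" where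
  "contains_pattern \<pi> \<sigma> \<longleftrightarrow>
     (\<exists>f :: nat \<Rightarrow> nat. strict_mono_on {..<length \<sigma>} f \<and> f ` {..<length \<sigma>} \<subseteq> {..<length \<pi>} \<and>
        (\<forall>a<length \<sigma>. \<forall>b<length \<sigma>. \<pi> ! f a < \<pi> ! f b \<longleftrightarrow> \<sigma> ! a < \<sigma> ! b))"

definition avoids :: "nat list \<Rightarrow> nat list \<Rightarrow> bool" where
  "avoids \<pi> \<sigma> \<longleftrightarrow> \<not> contains_pattern \<pi> \<sigma>"

definition RS :: "nat \<Rightarrow> nat list \<Rightarrow> nat list set" where
  "RS n \<sigma> = {\<pi> \<in> permutations_of_set {1..n}. simsun \<pi> \<and> avoids \<pi> \<sigma>}"

text \<open>
  A lattice path from the origin is given by its list of steps, so its vertices are the partial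
  sums.
\<close>

definition motzkin_paths :: "nat \<Rightarrow> (int \<times> int) list set" where
  "motzkin_paths n =
     {p. set p \<subseteq> {(1, 1), (1, -1), (1, 0)} \<and> sum_list p = (int n, 0) \<and>
         (\<forall>i\<le>length p. 0 \<le> snd (sum_list (take i p)))}"

definition motzkin :: "nat \<Rightarrow> nat" where
  "motzkin n = card (motzkin_paths n)"

end

theory Submission
  imports Defs "HOL-Library.Sublist"
begin

text \<open>
  The proof splits a permutation at its largest entry \<open>x\<close>, as \<open>L x R\<close>. Avoiding \<open>231\<close> forces every
  entry of \<open>L\<close> below every entry of \<open>R\<close>, and both parts must avoid \<open>231\<close> themselves
  (\<open>has_231_around_max\<close>). For such a word the simsun condition also splits
  (\<open>restrictions_ok_around_max\<close>): as long as \<open>x\<close> is not visible, there is an ascent where the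
  restriction of \<open>L\<close> meets the restriction of \<open>R\<close>, so no double descent crosses the border; once \<open>x\<close>
  is visible, the only new possible double descent consists of \<open>x\<close> and the first two entries of \<open>R\<close>.
  So \<open>L\<close> is any smaller object of the same kind, and \<open>R\<close> is one that does not start with a descent.

  Let \<open>a n\<close> count the \<open>231\<close>-avoiding simsun permutations of length \<open>n\<close>, and \<open>b n\<close> those among them
  that do not start with a descent. The splitting gives
  \<open>a (n + 1) = (\<Sum>k\<le>n. a k * b (n - k))\<close>. For \<open>n > 0\<close> the word \<open>L x R\<close> does not start with a
  descent exactly if \<open>L\<close> is nonempty and does not start with one, so
  \<open>b (n + 1) = (\<Sum>k=1..n. b k * b (n - k))\<close>. Substituting \<open>b (k + 1) = a k\<close> turns the second
  recurrence, shifted by one, into the first, so \<open>b (n + 1) = a n\<close> follows by induction from \<open>b 1 = a 0 = 1\<close>. As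
  \<open>b 0 = 1\<close>, the first recurrence then reads \<open>a (n + 1) = a n + (\<Sum>k<n. a k * a (n - 1 - k))\<close>. This
  is the recurrence of the Motzkin numbers (\<open>motzkin_Suc\<close>), where it comes from cutting a path at
  its first return to the axis.
\<close>

section \<open>Counting concatenations\<close>

text \<open>
  Every recurrence below counts words \<open>u x v\<close> by the length of \<open>u\<close>. In a fixed word the letter \<open>x\<close> may occur
  several times, so the lemma asks that at most one occurrence gives a split of the required kind. By
  symmetry it is enough to exclude a second split that is further to the right.
\<close>

lemma card_UN_glue:
  assumes "finite K"
    and "\<And>k. k \<in> K \<Longrightarrow> finite (A k)" "\<And>k. k \<in> K \<Longrightarrow> finite (B k)"
    and len: "\<And>k u. k \<in> K \<Longrightarrow> u \<in> A k \<Longrightarrow> length u = k"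
    and uniq: "\<And>u v u' v' j k. j \<in> K \<Longrightarrow> k \<in> K \<Longrightarrow> u \<in> A j \<Longrightarrow> u' \<in> A k \<Longrightarrow> v \<in> B j \<Longrightarrow>
                 v' \<in> B k \<Longrightarrow> u @ x # v = u' @ x # v' \<Longrightarrow> \<not> length u < length u'"
  shows "card (\<Union>k\<in>K. (\<lambda>(u, v). u @ x # v) ` (A k \<times> B k)) = (\<Sum>k\<in>K. card (A k) * card (B k))"
proof -
  let ?g = "\<lambda>(u, v). u @ x # v"
  have inj: "inj_on ?g (A k \<times> B k)" if "k \<in> K" for k
    using len[OF that] by (auto simp: inj_on_def)
  have disj: "?g ` (A j \<times> B j) \<inter> ?g ` (A k \<times> B k) = {}" if "j \<in> K" "k \<in> K" "j \<noteq> k" for j k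
  proof (rule ccontr)
    assume "\<not> ?thesis"
    then obtain u v u' v' where *: "u \<in> A j" "v \<in> B j" "u' \<in> A k" "v' \<in> B k"
      "u @ x # v = u' @ x # v'" by fastforce
    have "\<not> length u < length u'"
      by (rule uniq[OF that(1,2) *(1,3,2,4,5)])
    moreover have "\<not> length u' < length u"
      by (rule uniq[OF that(2,1) *(3,1,4,2) *(5)[symmetric]])
    ultimately show False using len[OF that(1) *(1)] len[OF that(2) *(3)] that(3) by simp
  qed
  have "card (\<Union>k\<in>K. ?g ` (A k \<times> B k)) = (\<Sum>k\<in>K. card (?g ` (A k \<times> B k)))"
    using assms(1-3) disj by (intro card_UN_disjoint) auto
  also have "\<dots> = (\<Sum>k\<in>K. card (A k) * card (B k))"
    by (intro sum.cong refl) (simp add: card_image[OF inj] card_cartesian_product)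
  finally show ?thesis .
qed

section \<open>The Motzkin recurrence\<close>

abbreviation height :: "(int \<times> int) list \<Rightarrow> int" where
  "height p \<equiv> snd (sum_list p)"

abbreviation stays_nonneg :: "(int \<times> int) list \<Rightarrow> bool" where
  "stays_nonneg p \<equiv> \<forall>i\<le>length p. 0 \<le> height (take i p)"

text \<open>
  Every step has first component 1, so the end point's abscissa only records the length of the path and
  all other conditions concern the height.
\<close>

lemma motzkin_paths_alt:
  "motzkin_paths n =
     {p. set p \<subseteq> {(1, 1), (1, -1), (1, 0)} \<and> length p = n \<and> height p = 0 \<and> stays_nonneg p}"
proof -
  have "fst (sum_list p) = int (length p)" if "set p \<subseteq> {(1, 1), (1, -1), (1, 0)}"
    for p :: "(int \<times> int) list"
    using that by (induction p) auto
  then show ?thesis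
    unfolding motzkin_paths_def by (auto simp: prod_eq_iff)
qed

lemma finite_motzkin_paths: "finite (motzkin_paths n)"
proof -
  have "finite {p :: (int \<times> int) list. set p \<subseteq> {(1, 1), (1, -1), (1, 0)} \<and> length p = n}"
    by (rule finite_lists_length_eq) auto
  then show ?thesis
    by (rule finite_subset[rotated]) (auto simp: motzkin_paths_alt)
qed

lemma motzkin_paths_0: "motzkin_paths 0 = {[]}"
  by (auto simp: motzkin_paths_alt)

lemma all_le_Suc_iff: "(\<forall>i\<le>Suc n. P i) \<longleftrightarrow> P 0 \<and> (\<forall>i\<le>n. P (Suc i))"
  by (metis Suc_le_mono le0 not0_implies_Suc)

lemma excursion_iff:
  "stays_nonneg ((1, 1) # q) \<longleftrightarrow> (\<forall>i\<le>length q. -1 \<le> height (take i q))"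
  by (auto simp: all_le_Suc_iff)

text \<open>
  The path \<open>q\<close> is what follows an initial up step, with heights measured from the end of that step.
  It is cut at the first moment at which it gets below 0. Heights drop by at most 1 per step, so that
  step leads from height 0 to height \<open>-1\<close>; afterwards the lower bound \<open>-1\<close> says that the rest is
  nonnegative relative to its own start.
\<close>

lemma first_return:
  assumes steps: "set q \<subseteq> {(1, 1), (1, -1), (1, 0)}"
    and low: "\<forall>i\<le>length q. -1 \<le> height (take i q)" and end_low: "height q = -1"
  obtains u v where "q = u @ (1, -1) # v" "height u = 0" "stays_nonneg u"
    "height v = 0" "stays_nonneg v"
proof -
  define i where "i = (LEAST i. height (take i q) < 0)"
  have ex: "height (take (length q) q) < 0" using end_low by simp
  have neg: "height (take i q) < 0" unfolding i_def by (rule LeastI, rule ex)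
  have before: "0 \<le> height (take j q)" if "j < i" for j
    using not_less_Least[of j "\<lambda>i. height (take i q) < 0"] that unfolding i_def by simp
  have i_le: "i \<le> length q" unfolding i_def by (rule Least_le, rule ex)
  have "i \<noteq> 0" using neg by (intro notI) simp
  then obtain j where j: "i = Suc j" by (cases i) auto
  have j_lt: "j < length q" using i_le j by simp
  have q: "q = take j q @ q ! j # drop (Suc j) q" using j_lt by (rule id_take_nth_drop)
  have h0: "0 \<le> height (take j q)" using before j by simp
  have "q ! j \<in> {(1, 1), (1, -1), (1, 0)}" using steps j_lt nth_mem by blast
  moreover have "height (take j q) + snd (q ! j) < 0"
    using neg j_lt by (simp add: j take_Suc_conv_app_nth)
  ultimately have step: "q ! j = (1, -1)" and hj: "height (take j q) = 0"
    using h0 by auto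
  have "height q = height (take j q) + snd (q ! j) + height (drop (Suc j) q)"
    by (subst q) simp
  then have hv: "height (drop (Suc j) q) = 0" using end_low step hj by simp
  have "0 \<le> height (take l (drop (Suc j) q))" if "l \<le> length (drop (Suc j) q)" for l
  proof -
    have "take (Suc j + l) q = take (Suc j) q @ take l (drop (Suc j) q)" by (rule take_add)
    then have "height (take (Suc j + l) q) = -1 + height (take l (drop (Suc j) q))"
      using j_lt hj step by (simp add: take_Suc_conv_app_nth)
    moreover have "-1 \<le> height (take (Suc j + l) q)"
      using low that j_lt by simp
    ultimately show ?thesis by simp
  qed
  then have "stays_nonneg (drop (Suc j) q)" by blast
  moreover have "stays_nonneg (take j q)" using before j by (auto simp: min_def)
  ultimately show ?thesis using that q step hj hv by metis
qed

text \<open>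
  The converse of \<open>first_return\<close>: such a concatenation is a path that may follow an initial up step.
\<close>

lemma elevated_concat:
  assumes "height u = 0" "stays_nonneg u" "height v = 0" "stays_nonneg v"
  shows "height (u @ (1, -1) # v) = -1"
    and "\<forall>i\<le>length (u @ (1, -1) # v). -1 \<le> height (take i (u @ (1, -1) # v))"
proof -
  show "height (u @ (1, -1) # v) = -1" using assms by simp
  show "\<forall>i\<le>length (u @ (1, -1) # v). -1 \<le> height (take i (u @ (1, -1) # v))"
  proof (intro allI impI)
    fix i assume i: "i \<le> length (u @ (1, -1) # v)"
    show "-1 \<le> height (take i (u @ (1, -1) # v))"
    proof (cases "i \<le> length u")
      case True
      then have "0 \<le> height (take i u)" using assms by blast
      then show ?thesis using True by simp
    next
      case False
      define l where "l = i - Suc (length u)"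
      have l: "i - length u = Suc l" "l \<le> length v" using False i by (auto simp: l_def)
      have "0 \<le> height (take l v)" using assms l by blast
      then show ?thesis using False assms(1) l(1) by simp
    qed
  qed
qed

lemma motzkin_paths_Suc:
  "motzkin_paths (Suc n) =
     (#) (1, 0) ` motzkin_paths n \<union>
     (#) (1, 1) ` (\<Union>k<n. (\<lambda>(u, v). u @ (1, -1) # v) ` (motzkin_paths k \<times> motzkin_paths (n - Suc k)))"
  (is "?M = ?F \<union> ?E")
proof (intro equalityI subsetI)
  fix p assume p: "p \<in> ?M"
  then obtain s q where sq: "p = s # q" by (cases p) (auto simp: motzkin_paths_alt)
  have steps: "s \<in> {(1, 1), (1, -1), (1, 0)}" "set q \<subseteq> {(1, 1), (1, -1), (1, 0)}"
    and len: "length q = n" and h: "snd s + height q = 0"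
    and nn: "\<And>i. i \<le> length q \<Longrightarrow> 0 \<le> snd s + height (take i q)"
    using p unfolding motzkin_paths_alt sq by (auto simp: all_le_Suc_iff)
  have "0 \<le> snd s" using nn[of 0] by simp
  then consider "s = (1, 0)" | "s = (1, 1)" using steps by auto
  then show "p \<in> ?F \<union> ?E"
  proof cases
    case 1
    then have "q \<in> motzkin_paths n" using steps len h nn by (auto simp: motzkin_paths_alt)
    then show ?thesis using 1 sq by blast
  next
    case 2
    have "\<forall>i\<le>length q. -1 \<le> height (take i q)"
    proof (intro allI impI)
      fix i assume "i \<le> length q"
      from nn[OF this] 2 show "-1 \<le> height (take i q)" by simp
    qed
    moreover have "height q = -1" using h 2 by simp
    ultimately obtain u v where uv: "q = u @ (1, -1) # v" "height u = 0" "stays_nonneg u"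
      "height v = 0" "stays_nonneg v" using first_return[OF steps(2)] by metis
    have "length u < n" "u \<in> motzkin_paths (length u)" "v \<in> motzkin_paths (n - Suc (length u))"
      using uv steps len by (auto simp: motzkin_paths_alt)
    then show ?thesis
      unfolding sq uv(1) 2
      by (intro UnI2 imageI UN_I[of "length u"] rev_image_eqI[of "(u, v)"]) simp_all
  qed
next
  fix p assume "p \<in> ?F \<union> ?E"
  then consider q where "p = (1, 0) # q" "q \<in> motzkin_paths n"
    | k u v where "p = (1, 1) # u @ (1, -1) # v" "k < n" "u \<in> motzkin_paths k"
        "v \<in> motzkin_paths (n - Suc k)"
    by auto
  then show "p \<in> ?M"
  proof cases
    case 1
    then show ?thesis by (auto simp: motzkin_paths_alt all_le_Suc_iff)
  next
    case 2
    then have uv: "height u = 0" "stays_nonneg u" "height v = 0" "stays_nonneg v"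
      by (auto simp: motzkin_paths_alt)
    have "stays_nonneg p" "height p = 0"
      unfolding 2(1) excursion_iff using elevated_concat[OF uv] by auto
    moreover have "set p \<subseteq> {(1, 1), (1, -1), (1, 0)}" "length p = Suc n"
      using 2 by (auto simp: motzkin_paths_alt)
    ultimately show ?thesis by (simp add: motzkin_paths_alt)
  qed
qed

lemma motzkin_0: "motzkin 0 = 1"
  by (simp add: motzkin_def motzkin_paths_0)

lemma motzkin_Suc:
  "motzkin (Suc n) = motzkin n + (\<Sum>k<n. motzkin k * motzkin (n - Suc k))"
proof -
  define E where
    "E = (\<Union>k<n. (\<lambda>(u, v). u @ (1, -1) # v) ` (motzkin_paths k \<times> motzkin_paths (n - Suc k)))"
  have fin: "finite E" unfolding E_def
    by (intro finite_UN_I finite_imageI finite_cartesian_product finite_motzkin_paths) simp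
  have "card E = (\<Sum>k<n. card (motzkin_paths k) * card (motzkin_paths (n - Suc k)))"
    unfolding E_def
  proof (rule card_UN_glue)
    fix u v u' v' :: "(int \<times> int) list" and j k
    assume u: "u \<in> motzkin_paths j" and u': "u' \<in> motzkin_paths k"
      and eq: "u @ (1, -1) # v = u' @ (1, -1) # v'"
    show "\<not> length u < length u'"
    proof
      assume less: "length u < length u'"
      (* If u were the shorter part, u followed by the down step would be a prefix of u',
         but it has height -1. *)
      have "take (Suc (length u)) (u' @ (1, -1) # v') = u @ [(1, -1)]"
        unfolding eq[symmetric] by simp
      then have "take (Suc (length u)) u' = u @ [(1, -1)]" using less by simp
      then have "height (take (Suc (length u)) u') = -1" using u by (simp add: motzkin_paths_alt)
      moreover have "0 \<le> height (take (Suc (length u)) u')"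
        using u' less unfolding motzkin_paths_alt by (simp add: Suc_le_eq)
      ultimately show False by simp
    qed
  next
    show "length u = k" if "u \<in> motzkin_paths k" for k u
      using that by (simp add: motzkin_paths_alt)
  qed (rule finite_lessThan finite_motzkin_paths)+
  moreover have "card (motzkin_paths (Suc n)) = card (motzkin_paths n) + card E"
  proof -
    have disj: "(#) (1, 0) ` A \<inter> (#) (1, 1) ` B = {}" for A B :: "(int \<times> int) list set"
      by auto
    have "card (motzkin_paths (Suc n)) = card ((#) (1, 0) ` motzkin_paths n) + card ((#) (1, 1) ` E)"
      unfolding motzkin_paths_Suc E_def[symmetric]
      by (intro card_Un_disjoint finite_imageI finite_motzkin_paths fin disj)
    then show ?thesis by (simp add: card_image)
  qed
  ultimately show ?thesis unfolding motzkin_def by simp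
qed

section \<open>Patterns and descents around the largest entry\<close>

text \<open>
  Subsequences instead of positions: a subsequence of a concatenation splits into subsequences of its
  parts, so no index arithmetic is needed.
\<close>

definition has_231 :: "nat list \<Rightarrow> bool" where
  "has_231 w \<longleftrightarrow> (\<exists>a b c. subseq [a, b, c] w \<and> c < a \<and> a < b)"

lemma subseq_Cons_left_iff:
  "subseq (a # xs) w \<longleftrightarrow> (\<exists>i<length w. w ! i = a \<and> subseq xs (drop (Suc i) w))"
proof
  assume "subseq (a # xs) w"
  then obtain u v where "w = u @ a # v" "subseq xs v" by (auto dest: list_emb_ConsD)
  then show "\<exists>i<length w. w ! i = a \<and> subseq xs (drop (Suc i) w)"
    by (intro exI[of _ "length u"]) auto
next
  assume "\<exists>i<length w. w ! i = a \<and> subseq xs (drop (Suc i) w)"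
  then obtain i where i: "i < length w" "w ! i = a" "subseq xs (drop (Suc i) w)" by blast
  then have "subseq (a # xs) (take i w @ w ! i # drop (Suc i) w)"
    by (intro list_emb_append2) simp
  then show "subseq (a # xs) w" using i id_take_nth_drop by metis
qed

lemma subseq_triple_iff:
  "subseq [a, b, c] w \<longleftrightarrow> (\<exists>i j k. i < j \<and> j < k \<and> k < length w \<and> w ! i = a \<and> w ! j = b \<and> w ! k = c)"
proof
  assume "subseq [a, b, c] w"
  then obtain i where i: "i < length w" "w ! i = a" "subseq [b, c] (drop (Suc i) w)"
    using subseq_Cons_left_iff by metis
  from i(3) obtain j where j: "j < length w - Suc i" "w ! (Suc i + j) = b"
      "subseq [c] (drop (Suc j) (drop (Suc i) w))"
    unfolding subseq_Cons_left_iff[of b] using i(1) by (metis length_drop nth_drop Suc_leI)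
  from j(3) have "c \<in> set (drop (Suc i + Suc j) w)"
    by (simp only: subseq_singleton_left drop_drop add.commute)
  then obtain k where "k < length w - (Suc i + Suc j)" "w ! (Suc i + Suc j + k) = c"
    unfolding in_set_conv_nth using j(1) by auto
  with i j show "\<exists>i j k. i < j \<and> j < k \<and> k < length w \<and> w ! i = a \<and> w ! j = b \<and> w ! k = c"
    by (intro exI[of _ i] exI[of _ "Suc i + j"] exI[of _ "Suc i + Suc j + k"]) auto
next
  assume "\<exists>i j k. i < j \<and> j < k \<and> k < length w \<and> w ! i = a \<and> w ! j = b \<and> w ! k = c"
  then obtain i j k where *: "i < j" "j < k" "k < length w" "w ! i = a" "w ! j = b" "w ! k = c"
    by blast
  have "drop (Suc j) w ! (k - Suc j) = c" "k - Suc j < length (drop (Suc j) w)"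
    using * by auto
  then have "subseq [c] (drop (Suc j) w)" unfolding subseq_singleton_left using nth_mem by metis
  moreover have "drop (Suc (j - Suc i)) (drop (Suc i) w) = drop (Suc j) w" using * by simp
  moreover have "j - Suc i < length (drop (Suc i) w)" "drop (Suc i) w ! (j - Suc i) = b"
    using * by auto
  ultimately have "subseq [b, c] (drop (Suc i) w)"
    unfolding subseq_Cons_left_iff[of b] by metis
  then show "subseq [a, b, c] w"
    unfolding subseq_Cons_left_iff[of a] using * by (intro exI[of _ i]) simp
qed

lemma contains_231_iff: "contains_pattern w [2, 3, 1] \<longleftrightarrow> has_231 w"
proof
  assume "contains_pattern w [2, 3, 1]"
  then obtain f :: "nat \<Rightarrow> nat" where f: "strict_mono_on {..<3} f" "f ` {..<3} \<subseteq> {..<length w}"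
    and o: "\<And>a b. a < 3 \<Longrightarrow> b < 3 \<Longrightarrow> w ! f a < w ! f b \<longleftrightarrow> [2, 3, 1 :: nat] ! a < [2, 3, 1] ! b"
    unfolding contains_pattern_def by (auto simp: numeral_3_eq_3)
  have "f 0 < f 1" "f 1 < f 2" using f(1) by (auto simp: strict_mono_on_def)
  moreover have "f 2 < length w" using f(2) by (simp add: image_subset_iff)
  moreover have "w ! f 2 < w ! f 0" "w ! f 0 < w ! f 1" using o[of 2 0] o[of 0 1] by simp_all
  ultimately show "has_231 w" unfolding has_231_def subseq_triple_iff by blast
next
  assume "has_231 w"
  then obtain i j k where *: "i < j" "j < k" "k < length w" "w ! k < w ! i" "w ! i < w ! j"
    unfolding has_231_def subseq_triple_iff by blast
  have lt3: "a < 3 \<longleftrightarrow> a = 0 \<or> a = 1 \<or> a = 2" for a :: nat by auto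
  have "strict_mono_on {..<3} (\<lambda>t. [i, j, k] ! t)"
    using * by (auto simp: strict_mono_on_def lt3)
  moreover have "(\<lambda>t. [i, j, k] ! t) ` {..<3} \<subseteq> {..<length w}" using * by (auto simp: lt3)
  moreover have "\<forall>a<3. \<forall>b<3. w ! ([i, j, k] ! a) < w ! ([i, j, k] ! b) \<longleftrightarrow>
      [2, 3, 1 :: nat] ! a < [2, 3, 1] ! b"
    using * by (auto simp: lt3)
  moreover have "length [2, 3, 1 :: nat] = 3" by simp
  ultimately show "contains_pattern w [2, 3, 1]"
    unfolding contains_pattern_def by metis
qed

lemma set_mono_subseq: "subseq xs ys \<Longrightarrow> set xs \<subseteq> set ys"
  by (metis subseq_conv_nths set_nths_subset)

text \<open>
  An occurrence of \<open>231\<close> that uses \<open>x\<close> must use it as its largest, middle entry, so it amounts to an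
  inversion between \<open>L\<close> and \<open>R\<close>. An occurrence that crosses from \<open>L\<close> to \<open>R\<close> without \<open>x\<close> contains such
  an inversion too, because the last entry of \<open>231\<close> is smaller than the first.
\<close>

lemma has_231_around_max:
  assumes max: "\<And>y. y \<in> set L \<union> set R \<Longrightarrow> y < x"
  shows "has_231 (L @ x # R) \<longleftrightarrow>
     has_231 L \<or> has_231 R \<or> (\<exists>l\<in>set L. \<exists>r\<in>set R. r < l)"
proof
  assume "has_231 (L @ x # R)"
  then obtain a b c where "subseq [a, b, c] (L @ x # R)" and lt: "c < a" "a < b"
    unfolding has_231_def by blast
  then obtain us vs where us: "[a, b, c] = us @ vs" "subseq us L" and vs: "subseq vs (x # R)"
    by (auto simp: subseq_append_iff)
  have subL: "set us \<subseteq> set L" and subR: "set vs \<subseteq> insert x (set R)"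
    using set_mono_subseq[OF us(2)] set_mono_subseq[OF vs] by simp_all
  have abc: "a \<in> set us \<union> set vs" "b \<in> set us \<union> set vs" "c \<in> set us \<union> set vs"
    using us(1)[THEN arg_cong, of set] by auto
  then have "a \<noteq> x" "c \<noteq> x"
    using lt max subL subR by (metis Un_iff insert_iff less_asym subsetD)+
  (* The occurrence lies in x # R, or lies in L, or has its first entry in L and its last in x # R. *)
  consider "us = []" | "us = [a, b, c]" "vs = []" | "a \<in> set us" "c \<in> set vs"
    using us(1) by (auto simp: Cons_eq_append_conv)
  then show "has_231 L \<or> has_231 R \<or> (\<exists>l\<in>set L. \<exists>r\<in>set R. r < l)"
  proof cases
    case 1
    then have "subseq [a, b, c] R" using vs us(1)[symmetric] \<open>a \<noteq> x\<close> by simp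
    then show ?thesis using lt unfolding has_231_def by blast
  next
    case 2
    then show ?thesis using lt us(2) unfolding has_231_def by blast
  next
    case 3
    then show ?thesis using lt subL subR \<open>c \<noteq> x\<close> by blast
  qed
next
  assume "has_231 L \<or> has_231 R \<or> (\<exists>l\<in>set L. \<exists>r\<in>set R. r < l)"
  then consider "has_231 L" | "has_231 R" | l r where "l \<in> set L" "r \<in> set R" "r < l"
    by blast
  then show "has_231 (L @ x # R)"
  proof cases
    case 1
    then obtain a b c where "subseq [a, b, c] L" "c < a" "a < b" unfolding has_231_def by blast
    then show ?thesis
      unfolding has_231_def by (intro exI[of _ a] exI[of _ b] exI[of _ c] conjI subseq_rev_drop_many)
  next
    case 2
    then obtain a b c where "subseq [a, b, c] R" "c < a" "a < b" unfolding has_231_def by blast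
    then show ?thesis
      unfolding has_231_def
      by (intro exI[of _ a] exI[of _ b] exI[of _ c] conjI subseq_drop_many list_emb_Cons)
  next
    case 3
    then have "subseq ([l] @ [x, r]) (L @ x # R)"
      by (intro list_emb_append_mono) (simp_all add: subseq_singleton_left)
    then show ?thesis
      using 3 max unfolding has_231_def by (intro exI[of _ l] exI[of _ x] exI[of _ r]) simp
  qed
qed

lemma has_double_descent_short [simp]:
  "\<not> has_double_descent []" "\<not> has_double_descent [a]" "\<not> has_double_descent [a, b]"
  by (auto simp: has_double_descent_def)

lemma has_double_descent_Cons [simp]:
  "has_double_descent (a # b # c # w) \<longleftrightarrow> a > b \<and> b > c \<or> has_double_descent (b # c # w)"
proof -
  have ex: "(\<exists>i. P i) \<longleftrightarrow> P 0 \<or> (\<exists>i. P (Suc i))" for P :: "nat \<Rightarrow> bool"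
    by (metis not0_implies_Suc)
  show ?thesis
    unfolding has_double_descent_def by (subst (1) ex) (simp add: nth_Cons_Suc)
qed

fun starts_with_descent :: "nat list \<Rightarrow> bool" where
  "starts_with_descent (a # b # w) \<longleftrightarrow> a > b"
| "starts_with_descent _ \<longleftrightarrow> False"

text \<open>
  Two consecutive descents that use entries of both parts would include the step from \<open>L\<close> to \<open>R\<close>.
\<close>

lemma has_double_descent_append:
  assumes "L \<noteq> [] \<Longrightarrow> R \<noteq> [] \<Longrightarrow> last L < hd R"
  shows "has_double_descent (L @ R) \<longleftrightarrow> has_double_descent L \<or> has_double_descent R"
  using assms
proof (induction L rule: induct_list012)
  case 1
  show ?case by simp
next
  case (2 a)
  show ?case
  proof (cases R rule: starts_with_descent.cases)
    case (1 b c R')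
    then show ?thesis using "2.prems" by auto
  qed simp_all
next
  case (3 a b L)
  have IH: "has_double_descent ((b # L) @ R) \<longleftrightarrow> has_double_descent (b # L) \<or> has_double_descent R"
    by (rule "3.IH"(2)) (use "3.prems" in simp)
  show ?case
  proof (cases L)
    case Nil
    show ?thesis using IH "3.prems" unfolding Nil by (cases R) auto
  next
    case (Cons c L')
    show ?thesis using IH unfolding Cons by simp
  qed
qed

lemma has_double_descent_around_max:
  assumes "\<And>y. y \<in> set L \<union> set R \<Longrightarrow> y < x"
  shows "has_double_descent (L @ x # R) \<longleftrightarrow>
     has_double_descent L \<or> has_double_descent R \<or> starts_with_descent R"
proof -
  have "has_double_descent (x # R) \<longleftrightarrow> has_double_descent R \<or> starts_with_descent R"
  proof (cases R rule: starts_with_descent.cases)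
    case (1 a b R')
    then have "a < x" using assms[of a] by simp
    then show ?thesis using 1 by auto
  qed simp_all
  moreover have "has_double_descent (L @ x # R) \<longleftrightarrow>
      has_double_descent L \<or> has_double_descent (x # R)"
    using assms[of "last L"] by (intro has_double_descent_append) simp
  ultimately show ?thesis by blast
qed

text \<open>
  The simsun condition without the bounds on \<open>k\<close> and independent of the set of entries, so that it can
  be applied to both parts of a permutation, although the entries of the right part do not start at 1.
\<close>

definition restrictions_ok :: "nat list \<Rightarrow> bool" where
  "restrictions_ok w \<longleftrightarrow> (\<forall>k. \<not> has_double_descent (filter (\<lambda>y. y \<le> k) w))"

lemma has_double_descent_length: "has_double_descent w \<Longrightarrow> 3 \<le> length w"
  by (auto simp: has_double_descent_def)

text \<open>
  A double descent needs three entries, so the restrictions to \<open>{1..k}\<close> with \<open>k < 3\<close> satisfy the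
  condition anyway, and those with \<open>k > n\<close> are the whole permutation.
\<close>

lemma simsun_iff:
  assumes "w \<in> permutations_of_set {0<..n}"
  shows "simsun w \<longleftrightarrow> restrictions_ok w"
proof -
  have w: "set w = {0<..n}" "distinct w" "length w = n"
    using assms by (auto simp: permutations_of_set_def distinct_card[symmetric])
  have le: "filter (\<lambda>y. y \<in> {1..k}) w = filter (\<lambda>y. y \<le> k) w" for k
    using w(1) by (intro filter_cong) auto
  have big: "filter (\<lambda>y. y \<le> k) w = w" if "n \<le> k" for k
    using w(1) that by (intro filter_True) auto
  have small: "\<not> has_double_descent (filter (\<lambda>y. y \<le> k) w)" if "k < 3" for k
  proof
    assume "has_double_descent (filter (\<lambda>y. y \<le> k) w)"
    then have "3 \<le> length (filter (\<lambda>y. y \<le> k) w)" by (rule has_double_descent_length)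
    also have "\<dots> = card (set (filter (\<lambda>y. y \<le> k) w))"
      using w(2) by (simp only: distinct_card distinct_filter)
    also have "\<dots> \<le> card {0<..k}" using w(1) by (intro card_mono) auto
    finally show False using that by simp
  qed
  have "has_double_descent w \<Longrightarrow> 3 \<le> n" using has_double_descent_length w(3) by blast
  then show ?thesis
    unfolding simsun_def restrictions_ok_def le w(3)
    using small big by (metis linorder_not_less nat_le_linear order_refl)
qed

text \<open>
  For \<open>k < x\<close> the restriction is that of \<open>L\<close> followed by that of \<open>R\<close>, with an ascent in between. For
  \<open>x \<le> k\<close> it is the whole word, where no descent ends at \<open>x\<close>, so a double descent
  through \<open>x\<close> begins there.
\<close>

lemma restrictions_ok_around_max:
  assumes max: "\<And>y. y \<in> set L \<union> set R \<Longrightarrow> y < x"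
    and LR: "\<And>l r. l \<in> set L \<Longrightarrow> r \<in> set R \<Longrightarrow> l < r"
  shows "restrictions_ok (L @ x # R) \<longleftrightarrow>
     restrictions_ok L \<and> restrictions_ok R \<and> \<not> starts_with_descent R"
proof -
  let ?f = "\<lambda>k. filter (\<lambda>y. y \<le> k)"
  let ?dd = has_double_descent
  have low: "?dd (?f k (L @ x # R)) \<longleftrightarrow> ?dd (?f k L) \<or> ?dd (?f k R)" if "k < x" for k
  proof -
    have "last (?f k L) < hd (?f k R)" if "?f k L \<noteq> []" "?f k R \<noteq> []"
      using that[THEN last_in_set] that[THEN hd_in_set] LR by simp
    then show ?thesis using that has_double_descent_append[of "?f k L" "?f k R"] by simp
  qed
  have all: "?f k L = L" "?f k R = R" if "x \<le> k" for k
    using max that by (fastforce intro: filter_True)+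
  have high: "?dd (?f k (L @ x # R)) \<longleftrightarrow> ?dd (?f k L) \<or> ?dd (?f k R) \<or> starts_with_descent R"
    if "x \<le> k" for k
    using that all[OF that] has_double_descent_around_max[of L R x] max by simp
  show ?thesis
    unfolding restrictions_ok_def using low high by (metis linorder_not_less order_refl)
qed

section \<open>The recurrence for the permutations\<close>

text \<open>
  The right part of a split has entries \<open>{a + k<..a + m}\<close>. Counting over arbitrary intervals makes it
  an object of the same kind without relabelling its entries.
\<close>

definition RS_interval :: "nat \<Rightarrow> nat \<Rightarrow> nat list set" where
  "RS_interval a m = {w \<in> permutations_of_set {a<..a + m}. restrictions_ok w \<and> \<not> has_231 w}"

definition RS_interval_asc :: "nat \<Rightarrow> nat \<Rightarrow> nat list set" where
  "RS_interval_asc a m = {w \<in> RS_interval a m. \<not> starts_with_descent w}"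

lemma RS_231_eq: "RS n [2, 3, 1] = RS_interval 0 n"
proof -
  have "{1..n} = {0<..n}" by auto
  then show ?thesis
    unfolding RS_def RS_interval_def avoids_def contains_231_iff using simsun_iff by auto
qed

lemma finite_RS_interval [simp]: "finite (RS_interval a m)" "finite (RS_interval_asc a m)"
  by (simp_all add: RS_interval_def RS_interval_asc_def)

lemma RS_interval_0: "RS_interval a 0 = {[]}"
  by (auto simp: RS_interval_def restrictions_ok_def has_231_def)

lemma length_RS_interval: "w \<in> RS_interval a m \<Longrightarrow> length w = m"
  by (auto simp: RS_interval_def permutations_of_set_def distinct_card[symmetric])

text \<open>
  This identifies the entries of the two parts of a split from their numbers alone.
\<close>

lemma initial_segment:
  fixes A B :: "nat set"
  assumes AB: "A \<union> B = {a<..a + m}" and lt: "\<And>x y. x \<in> A \<Longrightarrow> y \<in> B \<Longrightarrow> x < y"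
  shows "card A \<le> m" "A = {a<..a + card A}" "B = {a + card A<..a + m}"
proof -
  have fin: "finite A" using AB by (metis finite_Un finite_greaterThanAtMost)
  define c where "c = Max (insert a A)"
  have c: "c \<in> insert a A" "\<And>x. x \<in> A \<Longrightarrow> x \<le> c" "a \<le> c"
    using fin Max_in[of "insert a A"] by (auto simp: c_def)
  have cm: "c \<le> a + m" using c(1) AB by auto
  have A: "A = {a<..c}"
  proof (intro equalityI subsetI)
    fix x assume "x \<in> A"
    then show "x \<in> {a<..c}" using AB c(2) by auto
  next
    fix x assume x: "x \<in> {a<..c}"
    then have "x \<in> A \<union> B" "c \<in> A" using AB cm c(1) by auto
    then show "x \<in> A" using lt x by fastforce
  qed
  then have card: "a + card A = c" using c(3) by simp
  then show "A = {a<..a + card A}" using A by simp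
  show "card A \<le> m" using card cm by simp
  show "B = {a + card A<..a + m}"
  proof (intro equalityI subsetI)
    fix x assume x: "x \<in> B"
    have "c < x" using lt[OF _ x] c(1) AB x by auto
    then show "x \<in> {a + card A<..a + m}" using AB x card by auto
  next
    fix x assume "x \<in> {a + card A<..a + m}"
    then have "x \<in> A \<union> B" "x \<notin> A" using AB A card by auto
    then show "x \<in> B" by blast
  qed
qed

lemma RS_interval_Suc:
  "RS_interval a (Suc m) =
     (\<Union>k\<le>m. (\<lambda>(L, R). L @ (a + Suc m) # R) ` (RS_interval a k \<times> RS_interval_asc (a + k) (m - k)))"
  (is "?S = ?U")
proof (intro equalityI subsetI)
  let ?x = "a + Suc m"
  fix w assume w: "w \<in> ?S"
  then have "?x \<in> set w" by (simp add: RS_interval_def permutations_of_set_def)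
  then obtain L R where LR: "w = L @ ?x # R" by (metis split_list)
  have dist: "distinct (L @ ?x # R)" and set: "set L \<union> set R \<union> {?x} = {a<..a + Suc m}"
    and ok: "restrictions_ok (L @ ?x # R)" and avoid: "\<not> has_231 (L @ ?x # R)"
    using w unfolding LR RS_interval_def permutations_of_set_def by auto
  have "set L \<union> set R = {a<..a + Suc m} - {?x}" using dist set by auto
  also have "\<dots> = {a<..a + m}" by auto
  finally have un: "set L \<union> set R = {a<..a + m}" .
  then have max: "y < ?x" if "y \<in> set L \<union> set R" for y using that by auto
  have 231: "\<not> has_231 L" "\<not> has_231 R" "\<not> (\<exists>l\<in>set L. \<exists>r\<in>set R. r < l)"
    using avoid has_231_around_max[OF max] by blast+
  have lt: "l < r" if "l \<in> set L" "r \<in> set R" for l r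
    using 231(3) dist that by (metis disjoint_iff distinct_append linorder_neqE_nat list.set_intros(2))
  have ok': "restrictions_ok L" "restrictions_ok R" "\<not> starts_with_descent R"
    using ok restrictions_ok_around_max[OF max lt] by blast+
  have card: "card (set L) = length L" using dist by (simp add: distinct_card)
  have "L \<in> RS_interval a (length L)" "R \<in> RS_interval_asc (a + length L) (m - length L)" "length L \<le> m"
    using initial_segment[OF un lt] dist 231 ok' unfolding card
    by (auto simp: RS_interval_def RS_interval_asc_def permutations_of_set_def)
  then show "w \<in> ?U"
    unfolding LR by (intro UN_I[of "length L"] rev_image_eqI[of "(L, R)"]) simp_all
next
  let ?x = "a + Suc m"
  fix w assume "w \<in> ?U"
  then obtain k L R where k: "k \<le> m" and LR: "w = L @ ?x # R"
    and L: "L \<in> RS_interval a k" and R: "R \<in> RS_interval_asc (a + k) (m - k)" by auto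
  have set: "set L = {a<..a + k}" "set R = {a + k<..a + m}"
    using k L R by (auto simp: RS_interval_def RS_interval_asc_def permutations_of_set_def)
  have max: "y < ?x" if "y \<in> set L \<union> set R" for y using that k unfolding set by auto
  have lt: "l < r" if "l \<in> set L" "r \<in> set R" for l r using that unfolding set by auto
  have "\<not> has_231 w \<longleftrightarrow> \<not> (has_231 L \<or> has_231 R \<or> (\<exists>l\<in>set L. \<exists>r\<in>set R. r < l))"
    unfolding LR by (subst has_231_around_max) (rule max, assumption, rule refl)
  moreover have "restrictions_ok w \<longleftrightarrow>
      restrictions_ok L \<and> restrictions_ok R \<and> \<not> starts_with_descent R"
    unfolding LR by (rule restrictions_ok_around_max) (rule max lt, assumption+)+
  ultimately have "\<not> has_231 w" "restrictions_ok w"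
    using L R lt by (auto simp: RS_interval_def RS_interval_asc_def dest: less_asym)
  moreover have "set w = {a<..a + Suc m}" using k unfolding LR by (auto simp: set)
  moreover have "distinct w"
  proof -
    have "distinct L" "distinct R"
      using L R by (simp_all add: RS_interval_def RS_interval_asc_def permutations_of_set_def)
    moreover have "?x \<notin> set L \<union> set R" using max by blast
    moreover have "set L \<inter> set R = {}" using lt by blast
    ultimately show ?thesis unfolding LR by simp
  qed
  ultimately show "w \<in> ?S" by (simp add: RS_interval_def permutations_of_set_def)
qed

lemma starts_with_descent_around_max:
  assumes "\<And>y. y \<in> set L \<union> set R \<Longrightarrow> y < x" "L @ R \<noteq> []"
  shows "starts_with_descent (L @ x # R) \<longleftrightarrow> L = [] \<or> starts_with_descent L"
proof (cases L)
  case Nil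
  then show ?thesis using assms by (cases R) auto
next
  case (Cons l L')
  then have "l < x" using assms(1)[of l] by simp
  then show ?thesis using Cons by (cases L') auto
qed

text \<open>
  The index \<open>k = 0\<close> is missing because a word that begins with its largest entry starts with a descent,
  unless it has no other entry; that word is excluded by \<open>0 < m\<close>.
\<close>

lemma RS_interval_asc_Suc:
  assumes "0 < m"
  shows "RS_interval_asc a (Suc m) =
     (\<Union>k\<in>{1..m}. (\<lambda>(L, R). L @ (a + Suc m) # R) `
        (RS_interval_asc a k \<times> RS_interval_asc (a + k) (m - k)))"
proof -
  (* Since m > 0, the parts L and R are not both empty. *)
  have desc: "starts_with_descent (L @ (a + Suc m) # R) \<longleftrightarrow> k = 0 \<or> starts_with_descent L"
    if "k \<le> m" "L \<in> RS_interval a k" "R \<in> RS_interval_asc (a + k) (m - k)" for k L R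
  proof -
    have "set L = {a<..a + k}" "set R = {a + k<..a + m}"
      using that by (auto simp: RS_interval_def RS_interval_asc_def permutations_of_set_def)
    moreover have len: "length L = k" "length R = m - k"
      using that length_RS_interval by (auto simp: RS_interval_asc_def)
    ultimately show ?thesis
      using that(1) assms
      by (subst starts_with_descent_around_max) auto
  qed
  let ?g = "\<lambda>(L, R). L @ (a + Suc m) # R"
  have "RS_interval_asc a (Suc m) =
     (\<Union>k\<le>m. {w \<in> ?g ` (RS_interval a k \<times> RS_interval_asc (a + k) (m - k)). \<not> starts_with_descent w})"
    unfolding RS_interval_asc_def[of a "Suc m"] RS_interval_Suc by blast
  also have "\<dots> = (\<Union>k\<le>m. if k = 0 then {} else ?g ` (RS_interval_asc a k \<times> RS_interval_asc (a + k) (m - k)))"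
  proof (intro SUP_cong refl)
    fix k assume k: "k \<in> {..m}"
    have "{w \<in> g ` P. \<not> starts_with_descent w} = g ` {p \<in> P. \<not> starts_with_descent (g p)}"
      for g :: "nat list \<times> nat list \<Rightarrow> nat list" and P
      by blast
    moreover have "{p \<in> RS_interval a k \<times> RS_interval_asc (a + k) (m - k). \<not> starts_with_descent (?g p)} =
        (if k = 0 then {} else RS_interval_asc a k \<times> RS_interval_asc (a + k) (m - k))"
      using desc[of k] k unfolding RS_interval_asc_def[of a k] by auto
    ultimately show "{w \<in> ?g ` (RS_interval a k \<times> RS_interval_asc (a + k) (m - k)). \<not> starts_with_descent w} =
        (if k = 0 then {} else ?g ` (RS_interval_asc a k \<times> RS_interval_asc (a + k) (m - k)))"
      by (simp split: if_splits)
  qed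
  also have "\<dots> = (\<Union>k\<in>{1..m}. ?g ` (RS_interval_asc a k \<times> RS_interval_asc (a + k) (m - k)))"
  proof -
    have "(\<Union>k\<le>m. if k = 0 then {} else h k) = (\<Union>k\<in>{1..m}. h k)" for h :: "nat \<Rightarrow> nat list set"
      by (force split: if_splits)
    then show ?thesis .
  qed
  finally show ?thesis .
qed

lemma max_splits_uniquely:
  fixes a m :: nat
  assumes u': "set u' \<subseteq> {a<..a + m}" and eq: "u @ (a + Suc m) # v = u' @ (a + Suc m) # v'"
  shows "\<not> length u < length u'"
proof
  assume "length u < length u'"
  then have "u' ! length u = a + Suc m" using eq by (metis nth_append nth_append_length)
  moreover have "u' ! length u \<in> set u'" using \<open>length u < length u'\<close> by simp
  ultimately show False using u' by auto
qed

lemma card_RS_interval_Suc: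
  "card (RS_interval a (Suc m)) =
     (\<Sum>k\<le>m. card (RS_interval a k) * card (RS_interval_asc (a + k) (m - k)))"
  unfolding RS_interval_Suc
proof (rule card_UN_glue)
  fix u v u' v' j k
  assume "k \<in> {..m}" "u' \<in> RS_interval a k" and eq: "u @ (a + Suc m) # v = u' @ (a + Suc m) # v'"
  then have "set u' \<subseteq> {a<..a + m}" by (auto simp: RS_interval_def permutations_of_set_def)
  then show "\<not> length u < length u'" using eq by (rule max_splits_uniquely)
qed (auto dest: length_RS_interval)

lemma card_RS_interval_asc_Suc:
  assumes "0 < m"
  shows "card (RS_interval_asc a (Suc m)) =
     (\<Sum>k\<in>{1..m}. card (RS_interval_asc a k) * card (RS_interval_asc (a + k) (m - k)))"
  unfolding RS_interval_asc_Suc[OF assms]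
proof (rule card_UN_glue)
  fix u v u' v' j k
  assume "k \<in> {1..m}" "u' \<in> RS_interval_asc a k"
    and eq: "u @ (a + Suc m) # v = u' @ (a + Suc m) # v'"
  then have "set u' \<subseteq> {a<..a + m}"
    by (auto simp: RS_interval_def RS_interval_asc_def permutations_of_set_def)
  then show "\<not> length u < length u'" using eq by (rule max_splits_uniquely)
qed (auto simp: RS_interval_asc_def dest: length_RS_interval)

lemma RS_interval_asc_0: "RS_interval_asc a 0 = {[]}"
  by (auto simp: RS_interval_asc_def RS_interval_0)

lemma RS_interval_asc_1: "RS_interval_asc a (Suc 0) = {[Suc a]}"
proof -
  have "{a<..a + Suc 0} = {Suc a}" by auto
  then have "permutations_of_set {a<..a + Suc 0} = {[Suc a]}" by (simp only: permutations_of_set_singleton)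
  moreover have "restrictions_ok [Suc a]" by (simp add: restrictions_ok_def)
  moreover have "\<not> has_231 [Suc a]"
    unfolding has_231_def by (auto dest: list_emb_length)
  moreover have "\<not> starts_with_descent [Suc a]" by simp
  ultimately show ?thesis unfolding RS_interval_asc_def RS_interval_def by blast
qed

text \<open>
  The two counts are proved together, because the convolution for length \<open>m\<close> needs both for smaller
  lengths. Both reduce to the same convolution: in the second one, shifting the index by one turns
  the left factors \<open>card (RS_interval_asc a (Suc k))\<close> into Motzkin numbers.
\<close>

lemma card_RS_interval_motzkin:
  "card (RS_interval a m) = motzkin m \<and> card (RS_interval_asc a (Suc m)) = motzkin m"
proof (induction m arbitrary: a rule: less_induct)
  case (less m)
  show ?case
  proof (cases m)
    case 0
    then show ?thesis by (simp add: RS_interval_0 RS_interval_asc_1 motzkin_0)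
  next
    case (Suc n)
    have S: "card (RS_interval b k) = motzkin k" if "k \<le> n" for b k
      using less.IH that Suc by simp
    have T: "card (RS_interval_asc b (Suc k)) = motzkin k" if "k \<le> n" for b k
      using less.IH that Suc by simp
    (* The start of the interval is left arbitrary as b k, since the two uses differ in it. The summand
       for k = n has an empty right part and yields the first term of motzkin_Suc. *)
    have convolution: "(\<Sum>k\<le>n. motzkin k * card (RS_interval_asc (b k) (n - k))) = motzkin m" for b
    proof -
      have "(\<Sum>k\<le>n. motzkin k * card (RS_interval_asc (b k) (n - k))) =
          (\<Sum>k<n. motzkin k * card (RS_interval_asc (b k) (n - k))) + motzkin n"
        by (simp add: RS_interval_asc_0 flip: lessThan_Suc_atMost)
      also have "(\<Sum>k<n. motzkin k * card (RS_interval_asc (b k) (n - k))) =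
          (\<Sum>k<n. motzkin k * motzkin (n - Suc k))"
        using T by (intro sum.cong refl) (simp add: Suc_diff_Suc[symmetric])
      finally show ?thesis by (simp add: Suc motzkin_Suc)
    qed
    have "card (RS_interval a m) =
        (\<Sum>k\<le>n. motzkin k * card (RS_interval_asc (a + k) (n - k)))"
      unfolding Suc card_RS_interval_Suc using S by (intro sum.cong refl) simp
    then have count: "card (RS_interval a m) = motzkin m" using convolution by simp
    have "card (RS_interval_asc a (Suc m)) =
        (\<Sum>k\<in>{1..m}. card (RS_interval_asc a k) * card (RS_interval_asc (a + k) (m - k)))"
      by (rule card_RS_interval_asc_Suc) (simp add: Suc)
    also have "\<dots> = (\<Sum>k\<in>{0..n}. card (RS_interval_asc a (Suc k)) * card (RS_interval_asc (a + Suc k) (n - k)))"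
      unfolding Suc One_nat_def sum.shift_bounds_cl_Suc_ivl by simp
    also have "\<dots> = (\<Sum>k\<le>n. motzkin k * card (RS_interval_asc (a + Suc k) (n - k)))"
      using T by (intro sum.cong) auto
    also have "\<dots> = motzkin m" by (rule convolution)
    finally show ?thesis using count by blast
  qed
qed

theorem proposition5p1:
  fixes n :: nat
  shows "card (RS n [2, 3, 1]) = motzkin n"
  unfolding RS_231_eq using card_RS_interval_motzkin by blast

end
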